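(* Let $\mathcal{A}$ be an Ab3* abelian category. If $\mathcal{A}$ has enough projective effacements, then $\mathcal{A}$ is Ab4*.
   Context: An abelian category $\mathcal{A}$ is Ab3* if all set-indexed products exist in $\mathcal{A}$ (equivalently, it is complete). It is Ab4* if it is Ab3* and, for every set $\Sigma$ (viewed as a discrete category), the product functor $\prod_{\Sigma}=\lim_\Sigma:\mathrm{Fun}(\Sigma,\mathcal{A})\to\mathcal{A}$ is exact. An epimorphism $\pi:B\to A$ in $\mathcal{A}$ is a projective effacement if $\mathrm{Ext}^1_{\mathcal{A}}(\pi,X)=0$ for all $X\in\mathcal{A}$, where $\mathrm{Ext}^1_{\mathcal{A}}$ is the (possibly class-sized) Yoneda group of extensions and $\mathrm{Ext}^1_{\mathcal{A}}(\pi,X):\mathrm{Ext}^1_{\mathcal{A}}(A,X)\to\mathrm{Ext}^1_{\mathcal{A}}(B,X)$ is pullback along $\pi$; equivalently, for every epimorphism $p:E\to A$ there is a morphism $b:B\to E$ with $p\circ b=\pi$. $\mathcal{A}$ has enough projective effacements if every object $A\in\mathcal{A}$ admits a projective effacement $B\to A$. *)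

theory Defs
  imports "HOL-Algebra.Group" "HOL-Library.FuncSet"
begin

section \<open>Categories and functors\<close>

record ('o, 'm) category_data =
  obj :: "'o set"
  arr :: "'m set"
  src :: "'m \<Rightarrow> 'o"
  tgt :: "'m \<Rightarrow> 'o"
  ident :: "'o \<Rightarrow> 'm"
  cmp :: "'m \<Rightarrow> 'm \<Rightarrow> 'm"  (infixl "\<cdot>\<index>" 70)

definition Hom :: "('o, 'm, 'z) category_data_scheme \<Rightarrow> 'o \<Rightarrow> 'o \<Rightarrow> 'm set" where
  "Hom C A B = {f \<in> arr C. src C f = A \<and> tgt C f = B}"

locale category =
  fixes C :: "('o, 'm, 'z) category_data_scheme" (structure)
  assumes src_obj: "f \<in> arr C \<Longrightarrow> src C f \<in> obj C"
    and tgt_obj: "f \<in> arr C \<Longrightarrow> tgt C f \<in> obj C"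
    and ident_Hom: "A \<in> obj C \<Longrightarrow> ident C A \<in> Hom C A A"
    and cmp_Hom: "f \<in> Hom C A B \<Longrightarrow> g \<in> Hom C B D \<Longrightarrow> g \<cdot> f \<in> Hom C A D"
    and ident_left: "f \<in> Hom C A B \<Longrightarrow> ident C B \<cdot> f = f"
    and ident_right: "f \<in> Hom C A B \<Longrightarrow> f \<cdot> ident C A = f"
    and cmp_assoc: "f \<in> Hom C A B \<Longrightarrow> g \<in> Hom C B D \<Longrightarrow> h \<in> Hom C D E \<Longrightarrow>
      h \<cdot> (g \<cdot> f) = (h \<cdot> g) \<cdot> f"

definition monic :: "('o, 'm, 'z) category_data_scheme \<Rightarrow> 'm \<Rightarrow> bool" where
  "monic C m \<longleftrightarrow> m \<in> arr C \<and>
     (\<forall>T\<in>obj C. \<forall>u\<in>Hom C T (src C m). \<forall>v\<in>Hom C T (src C m).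
        m \<cdot>\<^bsub>C\<^esub> u = m \<cdot>\<^bsub>C\<^esub> v \<longrightarrow> u = v)"

definition epic :: "('o, 'm, 'z) category_data_scheme \<Rightarrow> 'm \<Rightarrow> bool" where
  "epic C e \<longleftrightarrow> e \<in> arr C \<and>
     (\<forall>T\<in>obj C. \<forall>u\<in>Hom C (tgt C e) T. \<forall>v\<in>Hom C (tgt C e) T.
        u \<cdot>\<^bsub>C\<^esub> e = v \<cdot>\<^bsub>C\<^esub> e \<longrightarrow> u = v)"

definition isomorphism :: "('o, 'm, 'z) category_data_scheme \<Rightarrow> 'm \<Rightarrow> bool" where
  "isomorphism C f \<longleftrightarrow> f \<in> arr C \<and>
     (\<exists>g\<in>Hom C (tgt C f) (src C f).
        g \<cdot>\<^bsub>C\<^esub> f = ident C (src C f) \<and> f \<cdot>\<^bsub>C\<^esub> g = ident C (tgt C f))"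

text \<open>The square with sides \<open>a : P \<rightarrow> X\<close>, \<open>b : P \<rightarrow> Y\<close>, \<open>f : X \<rightarrow> Z\<close>, \<open>g : Y \<rightarrow> Z\<close>.\<close>

definition is_pullback ::
  "('o, 'm, 'z) category_data_scheme \<Rightarrow> 'm \<Rightarrow> 'm \<Rightarrow> 'm \<Rightarrow> 'm \<Rightarrow> bool" where
  "is_pullback C a b f g \<longleftrightarrow>
     a \<in> arr C \<and> b \<in> arr C \<and> f \<in> arr C \<and> g \<in> arr C \<and>
     src C a = src C b \<and> tgt C a = src C f \<and> tgt C b = src C g \<and> tgt C f = tgt C g \<and>
     f \<cdot>\<^bsub>C\<^esub> a = g \<cdot>\<^bsub>C\<^esub> b \<and>
     (\<forall>T\<in>obj C. \<forall>x\<in>Hom C T (src C f). \<forall>y\<in>Hom C T (src C g).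
        f \<cdot>\<^bsub>C\<^esub> x = g \<cdot>\<^bsub>C\<^esub> y \<longrightarrow>
        (\<exists>!u. u \<in> Hom C T (src C a) \<and> a \<cdot>\<^bsub>C\<^esub> u = x \<and> b \<cdot>\<^bsub>C\<^esub> u = y))"

definition is_functor ::
  "('o, 'm, 'z) category_data_scheme \<Rightarrow> ('p, 'n, 'y) category_data_scheme \<Rightarrow>
   ('o \<Rightarrow> 'p) \<Rightarrow> ('m \<Rightarrow> 'n) \<Rightarrow> bool" where
  "is_functor C D Fo Fm \<longleftrightarrow>
     (\<forall>A\<in>obj C. Fo A \<in> obj D) \<and>
     (\<forall>A\<in>obj C. \<forall>B\<in>obj C. \<forall>f\<in>Hom C A B. Fm f \<in> Hom D (Fo A) (Fo B)) \<and>
     (\<forall>A\<in>obj C. Fm (ident C A) = ident D (Fo A)) \<and>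
     (\<forall>f\<in>arr C. \<forall>g\<in>arr C. tgt C f = src C g \<longrightarrow>
        Fm (g \<cdot>\<^bsub>C\<^esub> f) = Fm g \<cdot>\<^bsub>D\<^esub> Fm f)"


section \<open>Abelian categories\<close>

record ('o, 'm) preadditive_data = "('o, 'm) category_data" +
  add :: "'m \<Rightarrow> 'm \<Rightarrow> 'm"
  zero_arr :: "'o \<Rightarrow> 'o \<Rightarrow> 'm"

definition Hom_group ::
  "('o, 'm, 'z) preadditive_data_scheme \<Rightarrow> 'o \<Rightarrow> 'o \<Rightarrow> 'm monoid" where
  "Hom_group C A B = \<lparr>carrier = Hom C A B, monoid.mult = add C, one = zero_arr C A B\<rparr>"

locale preadditive_category =
  category C for C :: "('o, 'm, 'z) preadditive_data_scheme" (structure) +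
  assumes Hom_comm_group: "A \<in> obj C \<Longrightarrow> B \<in> obj C \<Longrightarrow> comm_group (Hom_group C A B)"
    and cmp_add_left: "f \<in> Hom C A B \<Longrightarrow> g \<in> Hom C B D \<Longrightarrow> h \<in> Hom C B D \<Longrightarrow>
      add C g h \<cdot> f = add C (g \<cdot> f) (h \<cdot> f)"
    and cmp_add_right: "f \<in> Hom C A B \<Longrightarrow> g \<in> Hom C A B \<Longrightarrow> h \<in> Hom C B D \<Longrightarrow>
      h \<cdot> add C f g = add C (h \<cdot> f) (h \<cdot> g)"

definition is_zero_object :: "('o, 'm, 'z) category_data_scheme \<Rightarrow> 'o \<Rightarrow> bool" where
  "is_zero_object C Z \<longleftrightarrow> Z \<in> obj C \<and>
     (\<forall>A\<in>obj C. (\<exists>!f. f \<in> Hom C Z A) \<and> (\<exists>!f. f \<in> Hom C A Z))"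

text \<open>Injections \<open>i : A \<rightarrow> S\<close>, \<open>j : B \<rightarrow> S\<close> and projections \<open>p : S \<rightarrow> A\<close>, \<open>q : S \<rightarrow> B\<close>.\<close>

definition is_biproduct ::
  "('o, 'm, 'z) preadditive_data_scheme \<Rightarrow> 'o \<Rightarrow> 'o \<Rightarrow> 'm \<Rightarrow> 'm \<Rightarrow> 'm \<Rightarrow> 'm \<Rightarrow> bool" where
  "is_biproduct C A B i j p q \<longleftrightarrow>
     A \<in> obj C \<and> B \<in> obj C \<and>
     (\<exists>S\<in>obj C. i \<in> Hom C A S \<and> j \<in> Hom C B S \<and> p \<in> Hom C S A \<and> q \<in> Hom C S B \<and>
        p \<cdot>\<^bsub>C\<^esub> i = ident C A \<and> q \<cdot>\<^bsub>C\<^esub> j = ident C B \<and>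
        q \<cdot>\<^bsub>C\<^esub> i = zero_arr C A B \<and> p \<cdot>\<^bsub>C\<^esub> j = zero_arr C B A \<and>
        add C (i \<cdot>\<^bsub>C\<^esub> p) (j \<cdot>\<^bsub>C\<^esub> q) = ident C S)"

definition is_kernel ::
  "('o, 'm, 'z) preadditive_data_scheme \<Rightarrow> 'm \<Rightarrow> 'm \<Rightarrow> bool" where
  "is_kernel C k f \<longleftrightarrow> k \<in> arr C \<and> f \<in> arr C \<and> tgt C k = src C f \<and>
     f \<cdot>\<^bsub>C\<^esub> k = zero_arr C (src C k) (tgt C f) \<and>
     (\<forall>T\<in>obj C. \<forall>h\<in>Hom C T (src C f). f \<cdot>\<^bsub>C\<^esub> h = zero_arr C T (tgt C f) \<longrightarrow>
        (\<exists>!u. u \<in> Hom C T (src C k) \<and> k \<cdot>\<^bsub>C\<^esub> u = h))"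

definition is_cokernel ::
  "('o, 'm, 'z) preadditive_data_scheme \<Rightarrow> 'm \<Rightarrow> 'm \<Rightarrow> bool" where
  "is_cokernel C c f \<longleftrightarrow> c \<in> arr C \<and> f \<in> arr C \<and> src C c = tgt C f \<and>
     c \<cdot>\<^bsub>C\<^esub> f = zero_arr C (src C f) (tgt C c) \<and>
     (\<forall>T\<in>obj C. \<forall>h\<in>Hom C (tgt C f) T. h \<cdot>\<^bsub>C\<^esub> f = zero_arr C (src C f) T \<longrightarrow>
        (\<exists>!u. u \<in> Hom C (tgt C c) T \<and> u \<cdot>\<^bsub>C\<^esub> c = h))"

locale abelian_category =
  preadditive_category C for C :: "('o, 'm, 'z) preadditive_data_scheme" (structure) +
  assumes ex_zero_object: "\<exists>Z. is_zero_object C Z"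
    and ex_biproduct: "A \<in> obj C \<Longrightarrow> B \<in> obj C \<Longrightarrow> \<exists>i j p q. is_biproduct C A B i j p q"
    and ex_kernel: "f \<in> arr C \<Longrightarrow> \<exists>k. is_kernel C k f"
    and ex_cokernel: "f \<in> arr C \<Longrightarrow> \<exists>c. is_cokernel C c f"
    and monic_normal: "monic C m \<Longrightarrow> \<exists>f. is_kernel C m f"
    and epic_normal: "epic C e \<Longrightarrow> \<exists>f. is_cokernel C e f"

definition short_exact :: "('o, 'm, 'z) preadditive_data_scheme \<Rightarrow> 'm \<Rightarrow> 'm \<Rightarrow> bool" where
  "short_exact C i p \<longleftrightarrow> is_kernel C i p \<and> is_cokernel C p i"

definition exact_functor ::
  "('o, 'm, 'z) preadditive_data_scheme \<Rightarrow> ('p, 'n, 'y) preadditive_data_scheme \<Rightarrow>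
   ('o \<Rightarrow> 'p) \<Rightarrow> ('m \<Rightarrow> 'n) \<Rightarrow> bool" where
  "exact_functor C D Fo Fm \<longleftrightarrow>
     is_functor C D Fo Fm \<and>
     (\<forall>A\<in>obj C. \<forall>B\<in>obj C. \<forall>f\<in>Hom C A B. \<forall>g\<in>Hom C A B.
        Fm (add C f g) = add D (Fm f) (Fm g)) \<and>
     (\<forall>i p. short_exact C i p \<longrightarrow> short_exact D (Fm i) (Fm p))"


section \<open>Products, Ab3* and Ab4*\<close>

definition is_product ::
  "('o, 'm, 'z) category_data_scheme \<Rightarrow> 'i set \<Rightarrow> ('i \<Rightarrow> 'o) \<Rightarrow> 'o \<Rightarrow> ('i \<Rightarrow> 'm) \<Rightarrow> bool" where
  "is_product C \<Sigma> X P pr \<longleftrightarrow>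
     P \<in> obj C \<and> (\<forall>i\<in>\<Sigma>. X i \<in> obj C \<and> pr i \<in> Hom C P (X i)) \<and>
     (\<forall>T\<in>obj C. \<forall>f. (\<forall>i\<in>\<Sigma>. f i \<in> Hom C T (X i)) \<longrightarrow>
        (\<exists>!h. h \<in> Hom C T P \<and> (\<forall>i\<in>\<Sigma>. pr i \<cdot>\<^bsub>C\<^esub> h = f i)))"

text \<open>The category of functors from the discrete category on \<open>\<Sigma>\<close> to \<open>C\<close>.\<close>

definition Fun_discrete ::
  "'i set \<Rightarrow> ('o, 'm, 'z) preadditive_data_scheme \<Rightarrow> ('i \<Rightarrow> 'o, 'i \<Rightarrow> 'm) preadditive_data" where
  "Fun_discrete \<Sigma> C =
     \<lparr>obj = (\<Pi>\<^sub>E i\<in>\<Sigma>. obj C),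
      arr = (\<Pi>\<^sub>E i\<in>\<Sigma>. arr C),
      src = (\<lambda>f. \<lambda>i\<in>\<Sigma>. src C (f i)),
      tgt = (\<lambda>f. \<lambda>i\<in>\<Sigma>. tgt C (f i)),
      ident = (\<lambda>X. \<lambda>i\<in>\<Sigma>. ident C (X i)),
      cmp = (\<lambda>g f. \<lambda>i\<in>\<Sigma>. g i \<cdot>\<^bsub>C\<^esub> f i),
      add = (\<lambda>f g. \<lambda>i\<in>\<Sigma>. add C (f i) (g i)),
      zero_arr = (\<lambda>X Y. \<lambda>i\<in>\<Sigma>. zero_arr C (X i) (Y i))\<rparr>"

definition product_cone ::
  "('o, 'm, 'z) category_data_scheme \<Rightarrow> 'i set \<Rightarrow> ('i \<Rightarrow> 'o) \<Rightarrow> 'o \<times> ('i \<Rightarrow> 'm)" where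
  "product_cone C \<Sigma> X = (SOME (P, pr). is_product C \<Sigma> X P pr)"

definition product_obj ::
  "('o, 'm, 'z) category_data_scheme \<Rightarrow> 'i set \<Rightarrow> ('i \<Rightarrow> 'o) \<Rightarrow> 'o" where
  "product_obj C \<Sigma> X = fst (product_cone C \<Sigma> X)"

definition product_proj ::
  "('o, 'm, 'z) category_data_scheme \<Rightarrow> 'i set \<Rightarrow> ('i \<Rightarrow> 'o) \<Rightarrow> 'i \<Rightarrow> 'm" where
  "product_proj C \<Sigma> X = snd (product_cone C \<Sigma> X)"

definition product_arr ::
  "('o, 'm, 'z) preadditive_data_scheme \<Rightarrow> 'i set \<Rightarrow> ('i \<Rightarrow> 'm) \<Rightarrow> 'm" where
  "product_arr C \<Sigma> f =
     (let X = src (Fun_discrete \<Sigma> C) f; Y = tgt (Fun_discrete \<Sigma> C) f in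
      THE h. h \<in> Hom C (product_obj C \<Sigma> X) (product_obj C \<Sigma> Y) \<and>
        (\<forall>i\<in>\<Sigma>. product_proj C \<Sigma> Y i \<cdot>\<^bsub>C\<^esub> h = f i \<cdot>\<^bsub>C\<^esub> product_proj C \<Sigma> X i))"

text \<open>
  The distinction between sets and proper classes is relative to a predicate \<open>small\<close>, which
  says which collections of indices count as sets.
\<close>

definition Ab3star :: "('i set \<Rightarrow> bool) \<Rightarrow> ('o, 'm, 'z) category_data_scheme \<Rightarrow> bool" where
  "Ab3star small C \<longleftrightarrow>
     (\<forall>\<Sigma>. small \<Sigma> \<longrightarrow> (\<forall>X. (\<forall>i\<in>\<Sigma>. X i \<in> obj C) \<longrightarrow> (\<exists>P pr. is_product C \<Sigma> X P pr)))"

definition Ab4star :: "('i set \<Rightarrow> bool) \<Rightarrow> ('o, 'm, 'z) preadditive_data_scheme \<Rightarrow> bool" where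
  "Ab4star small C \<longleftrightarrow> Ab3star small C \<and>
     (\<forall>\<Sigma>. small \<Sigma> \<longrightarrow>
        exact_functor (Fun_discrete \<Sigma> C) C (product_obj C \<Sigma>) (product_arr C \<Sigma>))"


section \<open>Yoneda extensions and projective effacements\<close>

text \<open>A pair \<open>(i, p)\<close> stands for the extension \<open>0 \<rightarrow> X \<rightarrow> E \<rightarrow> A \<rightarrow> 0\<close> with maps \<open>i\<close> and \<open>p\<close>.\<close>

definition extensions ::
  "('o, 'm, 'z) preadditive_data_scheme \<Rightarrow> 'o \<Rightarrow> 'o \<Rightarrow> ('m \<times> 'm) set" where
  "extensions C A X = {(i, p). short_exact C i p \<and> src C i = X \<and> tgt C p = A}"

definition extension_equiv ::
  "('o, 'm, 'z) preadditive_data_scheme \<Rightarrow> 'o \<Rightarrow> 'o \<Rightarrow> (('m \<times> 'm) \<times> ('m \<times> 'm)) set" where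
  "extension_equiv C A X =
     {((i, p), (i', p')). (i, p) \<in> extensions C A X \<and> (i', p') \<in> extensions C A X \<and>
        (\<exists>\<phi>\<in>Hom C (src C p) (src C p'). isomorphism C \<phi> \<and>
           \<phi> \<cdot>\<^bsub>C\<^esub> i = i' \<and> p' \<cdot>\<^bsub>C\<^esub> \<phi> = p)}"

definition Ext1 ::
  "('o, 'm, 'z) preadditive_data_scheme \<Rightarrow> 'o \<Rightarrow> 'o \<Rightarrow> ('m \<times> 'm) set set" where
  "Ext1 C A X = extensions C A X // extension_equiv C A X"

text \<open>
  The neutral element for the Baer sum: the class of \<open>0 \<rightarrow> X \<rightarrow> X \<oplus> A \<rightarrow> A \<rightarrow> 0\<close>.
\<close>

definition Ext1_zero ::
  "('o, 'm, 'z) preadditive_data_scheme \<Rightarrow> 'o \<Rightarrow> 'o \<Rightarrow> ('m \<times> 'm) set" where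
  "Ext1_zero C A X =
     extension_equiv C A X `` {(i, p). \<exists>j q. is_biproduct C X A i j q p}"

text \<open>
  The class of the pullback of the extensions in \<open>c\<close> along \<open>\<pi> : B \<rightarrow> A\<close>; it consists of all
  extensions \<open>(i', p')\<close> of \<open>B\<close> by \<open>X\<close> fitting into a diagram
  \<open>X \<rightarrow> E' \<rightarrow> B\<close> over \<open>X \<rightarrow> E \<rightarrow> A\<close> that is the identity on \<open>X\<close> and whose right square is
  cartesian.
\<close>

definition Ext1_map ::
  "('o, 'm, 'z) preadditive_data_scheme \<Rightarrow> 'm \<Rightarrow> 'o \<Rightarrow> ('m \<times> 'm) set \<Rightarrow> ('m \<times> 'm) set" where
  "Ext1_map C \<pi> X c =
     {(i', p') \<in> extensions C (src C \<pi>) X.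
        \<exists>(i, p)\<in>c. \<exists>\<phi>. is_pullback C \<phi> p' p \<pi> \<and> \<phi> \<cdot>\<^bsub>C\<^esub> i' = i}"

definition projective_effacement ::
  "('o, 'm, 'z) preadditive_data_scheme \<Rightarrow> 'm \<Rightarrow> bool" where
  "projective_effacement C \<pi> \<longleftrightarrow> epic C \<pi> \<and>
     (\<forall>X\<in>obj C. \<forall>c\<in>Ext1 C (tgt C \<pi>) X. Ext1_map C \<pi> X c = Ext1_zero C (src C \<pi>) X)"

definition enough_projective_effacements ::
  "('o, 'm, 'z) preadditive_data_scheme \<Rightarrow> bool" where
  "enough_projective_effacements C \<longleftrightarrow>
     (\<forall>A\<in>obj C. \<exists>\<pi>. projective_effacement C \<pi> \<and> tgt C \<pi> = A)"

end

theory Submission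
  imports Defs
begin

text \<open>
  Products preserve kernels, so only epimorphisms matter. Given epimorphisms
  \<open>p\<^sub>i : B\<^sub>i \<rightarrow> A\<^sub>i\<close>, choose a projective effacement \<open>\<pi> : P \<rightarrow> \<Prod>A\<^sub>i\<close>. It lifts through the
  pullback of each \<open>p\<^sub>i\<close> along the projection \<open>\<Prod>A\<^sub>i \<rightarrow> A\<^sub>i\<close>, and the resulting maps \<open>P \<rightarrow> B\<^sub>i\<close>
  assemble to a lift of \<open>\<pi>\<close> through \<open>\<Prod>p\<^sub>i\<close>. As \<open>\<pi>\<close> is epic, so is \<open>\<Prod>p\<^sub>i\<close>.
\<close>

section \<open>Cancelling epimorphisms, and the universal property of products\<close>

context category
begin

lemma HomD:
  assumes "f \<in> Hom C A B"
  shows "f \<in> arr C" "src C f = A" "tgt C f = B"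
  using assms by (simp_all add: Hom_def)

lemma Hom_obj:
  assumes "f \<in> Hom C A B"
  shows "A \<in> obj C" "B \<in> obj C"
  using assms src_obj tgt_obj by (auto simp: Hom_def)

lemma epic_cancel:
  assumes "epic C e" "e \<in> Hom C A B" "u \<in> Hom C B T" "v \<in> Hom C B T" "u \<cdot> e = v \<cdot> e"
  shows "u = v"
  using assms Hom_obj(2)[OF assms(3)] unfolding epic_def by (auto simp: HomD(3))

lemma epicI:
  assumes "e \<in> Hom C A B"
    and "\<And>T u v. u \<in> Hom C B T \<Longrightarrow> v \<in> Hom C B T \<Longrightarrow> u \<cdot> e = v \<cdot> e \<Longrightarrow> u = v"
  shows "epic C e"
  unfolding epic_def using assms(2) HomD[OF assms(1)] by metis

lemma epic_cmpD:
  assumes f: "f \<in> Hom C A B" and g: "g \<in> Hom C B D" and ep: "epic C (g \<cdot> f)"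
  shows "epic C g"
proof (rule epicI[OF g])
  fix T u v
  assume u: "u \<in> Hom C D T" and v: "v \<in> Hom C D T" and eq: "u \<cdot> g = v \<cdot> g"
  have "u \<cdot> (g \<cdot> f) = v \<cdot> (g \<cdot> f)"
    using eq cmp_assoc[OF f g u] cmp_assoc[OF f g v] by simp
  then show "u = v" using epic_cancel[OF ep cmp_Hom[OF f g] u v] by simp
qed

text \<open>Both maps are lifts of the one family \<open>pr i \<cdot> v\<close>, and such a lift is
  unique; so the projections of a product are jointly monic.\<close>

lemma product_eqI:
  assumes P: "is_product C \<Sigma> X P pr" and u: "u \<in> Hom C T P" and v: "v \<in> Hom C T P"
    and eq: "\<And>i. i \<in> \<Sigma> \<Longrightarrow> pr i \<cdot> u = pr i \<cdot> v"
  shows "u = v"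
proof -
  have "T \<in> obj C" using Hom_obj(1)[OF u] .
  moreover have "\<forall>i\<in>\<Sigma>. pr i \<cdot> v \<in> Hom C T (X i)"
    using P v cmp_Hom unfolding is_product_def by blast
  ultimately have "\<exists>!h. h \<in> Hom C T P \<and> (\<forall>i\<in>\<Sigma>. pr i \<cdot> h = pr i \<cdot> v)"
    using P unfolding is_product_def by (elim conjE) (drule (1) bspec, erule allE, erule (1) mp)
  then show ?thesis using u v eq by blast
qed

lemma product_lift:
  assumes P: "is_product C \<Sigma> X P pr" and T: "T \<in> obj C"
    and f: "\<And>i. i \<in> \<Sigma> \<Longrightarrow> f i \<in> Hom C T (X i)"
  obtains h where "h \<in> Hom C T P" "\<And>i. i \<in> \<Sigma> \<Longrightarrow> pr i \<cdot> h = f i"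
proof -
  have "\<forall>i\<in>\<Sigma>. f i \<in> Hom C T (X i)" using f by blast
  then have "\<exists>!h. h \<in> Hom C T P \<and> (\<forall>i\<in>\<Sigma>. pr i \<cdot> h = f i)"
    using P T unfolding is_product_def by (elim conjE) (drule (1) bspec, erule allE, erule (1) mp)
  then show ?thesis using that by blast
qed

end

section \<open>Arithmetic of arrows, kernels and cokernels, and split extensions\<close>

context preadditive_category
begin

text \<open>Reduces typing in the functor category to components. The \<open>extensional\<close>
  conditions fix all values off \<open>\<Sigma>\<close>, so that equality of families can be tested
  on \<open>\<Sigma>\<close> alone.\<close>

lemma Hom_Fun_discrete:
  "f \<in> Hom (Fun_discrete \<Sigma> C) X Y \<longleftrightarrow>
     f \<in> extensional \<Sigma> \<and> X \<in> extensional \<Sigma> \<and> Y \<in> extensional \<Sigma> \<and>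
     (\<forall>i\<in>\<Sigma>. f i \<in> Hom C (X i) (Y i))"
  (is "?L \<longleftrightarrow> ?R")
proof
  assume ?L
  then show ?R unfolding Hom_def Fun_discrete_def by (auto simp: PiE_iff)
next
  assume ?R
  moreover from this have "(\<lambda>i\<in>\<Sigma>. src C (f i)) = X" "(\<lambda>i\<in>\<Sigma>. tgt C (f i)) = Y"
    by (auto simp: fun_eq_iff extensional_def Hom_def)
  ultimately show ?L unfolding Hom_def Fun_discrete_def by (auto simp: PiE_iff)
qed

lemma zero_Hom: "A \<in> obj C \<Longrightarrow> B \<in> obj C \<Longrightarrow> zero_arr C A B \<in> Hom C A B"
  using comm_group.axioms(2)[OF Hom_comm_group, THEN group.axioms(1), THEN monoid.one_closed]
  by (simp add: Hom_group_def)

lemma add_Hom: "f \<in> Hom C A B \<Longrightarrow> g \<in> Hom C A B \<Longrightarrow> add C f g \<in> Hom C A B"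
  using comm_group.axioms(2)[OF Hom_comm_group, THEN group.axioms(1), THEN monoid.m_closed, of A B f g]
    Hom_obj[of f A B]
  by (simp add: Hom_group_def)

lemma add_zero_left: "f \<in> Hom C A B \<Longrightarrow> add C (zero_arr C A B) f = f"
  using comm_group.axioms(2)[OF Hom_comm_group, THEN group.axioms(1), THEN monoid.l_one, of A B f]
    Hom_obj[of f A B]
  by (simp add: Hom_group_def)

lemma add_zero_right: "f \<in> Hom C A B \<Longrightarrow> add C f (zero_arr C A B) = f"
  using comm_group.axioms(2)[OF Hom_comm_group, THEN group.axioms(1), THEN monoid.r_one, of A B f]
    Hom_obj[of f A B]
  by (simp add: Hom_group_def)

lemma add_right_cancel:
  assumes "f \<in> Hom C A B" "g \<in> Hom C A B" "h \<in> Hom C A B" "add C f h = add C g h"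
  shows "f = g"
  using group.right_cancel[OF comm_group.axioms(2)[OF Hom_comm_group], of A B h f g]
    Hom_obj[OF assms(1)] assms
  by (simp add: Hom_group_def)

lemma ex_neg:
  assumes "f \<in> Hom C A B"
  obtains g where "g \<in> Hom C A B" "add C f g = zero_arr C A B"
  using group.r_inv_ex[OF comm_group.axioms(2)[OF Hom_comm_group], of A B f]
    Hom_obj[OF assms] assms that
  by (auto simp: Hom_group_def)

text \<open>Zero is its own double, so by bilinearity the composite is too; cancelling one copy in
  the group of arrows leaves zero. The same argument gives \<open>cmp_zero\<close>.\<close>

lemma zero_cmp:
  assumes f: "f \<in> Hom C A B" and D: "D \<in> obj C"
  shows "zero_arr C B D \<cdot> f = zero_arr C A D"
proof -
  have A: "A \<in> obj C" and B: "B \<in> obj C" using Hom_obj[OF f] by auto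
  note z = zero_Hom[OF B D]
  note zf = cmp_Hom[OF f z]
  have "add C (zero_arr C B D \<cdot> f) (zero_arr C B D \<cdot> f) = zero_arr C B D \<cdot> f"
    using cmp_add_left[OF f z z] add_zero_left[OF z] by simp
  also have "\<dots> = add C (zero_arr C A D) (zero_arr C B D \<cdot> f)"
    using add_zero_left[OF zf] by simp
  finally show ?thesis using add_right_cancel[OF zf zero_Hom[OF A D] zf] by simp
qed

lemma cmp_zero:
  assumes f: "f \<in> Hom C B D" and A: "A \<in> obj C"
  shows "f \<cdot> zero_arr C A B = zero_arr C A D"
proof -
  have B: "B \<in> obj C" and D: "D \<in> obj C" using Hom_obj[OF f] by auto
  note z = zero_Hom[OF A B]
  note fz = cmp_Hom[OF z f]
  have "add C (f \<cdot> zero_arr C A B) (f \<cdot> zero_arr C A B) = f \<cdot> zero_arr C A B"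
    using cmp_add_right[OF z z f] add_zero_left[OF z] by simp
  also have "\<dots> = add C (zero_arr C A D) (f \<cdot> zero_arr C A B)"
    using add_zero_left[OF fz] by simp
  finally show ?thesis using add_right_cancel[OF fz zero_Hom[OF A D] fz] by simp
qed

text \<open>With \<open>w\<close> the negative of \<open>v\<close>, the arrow
  \<open>add C u w\<close> composes with \<open>e\<close> to zero, hence is itself zero, and
  \<open>w\<close> can be cancelled.\<close>

lemma epic_if_zero_cancel:
  assumes e: "e \<in> Hom C A B"
    and zero: "\<And>T u. u \<in> Hom C B T \<Longrightarrow> u \<cdot> e = zero_arr C A T \<Longrightarrow> u = zero_arr C B T"
  shows "epic C e"
proof (rule epicI[OF e])
  fix T u v
  assume u: "u \<in> Hom C B T" and v: "v \<in> Hom C B T" and eq: "u \<cdot> e = v \<cdot> e"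
  obtain w where w: "w \<in> Hom C B T" and vw: "add C v w = zero_arr C B T" using ex_neg[OF v] .
  have "add C u w \<cdot> e = add C v w \<cdot> e"
    using cmp_add_left[OF e u w] cmp_add_left[OF e v w] eq by simp
  also have "\<dots> = zero_arr C A T" using vw zero_cmp[OF e Hom_obj(2)[OF u]] by simp
  finally have "add C u w = add C v w" using zero[OF add_Hom[OF u w]] vw by simp
  then show "u = v" using add_right_cancel[OF u v w] by simp
qed

text \<open>Separates the unique factorization into existence and left cancellation by
  \<open>k\<close>, which are proved by different arguments later. In the dual
  \<open>cokernelI\<close>, \<open>epic C c\<close> supplies the uniqueness.\<close>

lemma kernelI:
  assumes k: "k \<in> Hom C K A" and f: "f \<in> Hom C A B" and fk: "f \<cdot> k = zero_arr C K B"
    and lift: "\<And>T h. h \<in> Hom C T A \<Longrightarrow> f \<cdot> h = zero_arr C T B \<Longrightarrow> \<exists>u\<in>Hom C T K. k \<cdot> u = h"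
    and unique: "\<And>T u v. u \<in> Hom C T K \<Longrightarrow> v \<in> Hom C T K \<Longrightarrow> k \<cdot> u = k \<cdot> v \<Longrightarrow> u = v"
  shows "is_kernel C k f"
  unfolding is_kernel_def
  using HomD[OF k] HomD[OF f] fk
proof (intro conjI ballI impI)
  fix T h
  assume "h \<in> Hom C T (src C f)" "f \<cdot> h = zero_arr C T (tgt C f)"
  then have "\<exists>u\<in>Hom C T K. k \<cdot> u = h" using lift HomD[OF f] by simp
  then show "\<exists>!u. u \<in> Hom C T (src C k) \<and> k \<cdot> u = h"
    using unique HomD[OF k] by metis
qed simp_all

lemma cokernelI:
  assumes c: "c \<in> Hom C B Q" and f: "f \<in> Hom C A B" and cf: "c \<cdot> f = zero_arr C A Q"
    and lift: "\<And>T h. h \<in> Hom C B T \<Longrightarrow> h \<cdot> f = zero_arr C A T \<Longrightarrow> \<exists>u\<in>Hom C Q T. u \<cdot> c = h"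
    and epic: "epic C c"
  shows "is_cokernel C c f"
  unfolding is_cokernel_def
  using HomD[OF c] HomD[OF f] cf
proof (intro conjI ballI impI)
  fix T h
  assume "h \<in> Hom C (tgt C f) T" "h \<cdot> f = zero_arr C (src C f) T"
  then have "\<exists>u\<in>Hom C Q T. u \<cdot> c = h" using lift HomD[OF f] by simp
  then show "\<exists>!u. u \<in> Hom C (tgt C c) T \<and> u \<cdot> c = h"
    using epic_cancel[OF epic c] HomD[OF c] by metis
qed simp_all

lemma kernel_lift:
  assumes "is_kernel C k f" "k \<in> Hom C K A" "f \<in> Hom C A B"
    "h \<in> Hom C T A" "f \<cdot> h = zero_arr C T B"
  obtains u where "u \<in> Hom C T K" "k \<cdot> u = h"
proof -
  have "T \<in> obj C" using Hom_obj(1)[OF assms(4)] .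
  then have "\<exists>!u. u \<in> Hom C T K \<and> k \<cdot> u = h"
    using assms unfolding is_kernel_def by (auto simp: HomD)
  then show ?thesis using that by blast
qed

lemma cokernel_lift:
  assumes "is_cokernel C c f" "c \<in> Hom C B Q" "f \<in> Hom C A B"
    "h \<in> Hom C B T" "h \<cdot> f = zero_arr C A T"
  obtains u where "u \<in> Hom C Q T" "u \<cdot> c = h"
proof -
  have "T \<in> obj C" using Hom_obj(2)[OF assms(4)] .
  then have "\<exists>!u. u \<in> Hom C Q T \<and> u \<cdot> c = h"
    using assms unfolding is_cokernel_def by (auto simp: HomD)
  then show ?thesis using that by blast
qed

lemma kernel_Hom:
  assumes "is_kernel C k f" "f \<in> Hom C A B"
  shows "k \<in> Hom C (src C k) A" "f \<cdot> k = zero_arr C (src C k) B"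
  using assms unfolding is_kernel_def Hom_def by auto

text \<open>The decomposition of the identity of \<open>S\<close> does the work: an arrow
  \<open>h\<close> with \<open>p \<cdot> h\<close> zero equals
  \<open>i \<cdot> (q \<cdot> h)\<close>, and dually one with \<open>h \<cdot> i\<close> zero equals
  \<open>(h \<cdot> j) \<cdot> p\<close>. Uniqueness comes from the retraction \<open>q\<close> of
  \<open>i\<close> and the section \<open>j\<close> of \<open>p\<close>.\<close>

lemma biproduct_short_exact:
  assumes bp: "is_biproduct C X B i j q p"
  shows "short_exact C i p"
proof -
  obtain S where i: "i \<in> Hom C X S" and j: "j \<in> Hom C B S" and q: "q \<in> Hom C S X"
    and p: "p \<in> Hom C S B" and qi: "q \<cdot> i = ident C X" and pj: "p \<cdot> j = ident C B"
    and pi: "p \<cdot> i = zero_arr C X B" and sum: "add C (i \<cdot> q) (j \<cdot> p) = ident C S"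
    using bp unfolding is_biproduct_def by blast
  note iq = cmp_Hom[OF q i] and jp = cmp_Hom[OF p j]
  note X = Hom_obj(1)[OF i] and S = Hom_obj(2)[OF i] and B = Hom_obj(1)[OF j]
  have "is_kernel C i p"
  proof (rule kernelI[OF i p pi])
    fix T h
    assume h: "h \<in> Hom C T S" and ph: "p \<cdot> h = zero_arr C T B"
    note T = Hom_obj(1)[OF h]
    have "h = add C (i \<cdot> q) (j \<cdot> p) \<cdot> h" using sum ident_left[OF h] by simp
    also have "\<dots> = add C (i \<cdot> (q \<cdot> h)) (j \<cdot> (p \<cdot> h))"
      using cmp_add_left[OF h iq jp] cmp_assoc[OF h q i] cmp_assoc[OF h p j] by simp
    also have "\<dots> = i \<cdot> (q \<cdot> h)"
      using ph cmp_zero[OF j T] add_zero_right[OF cmp_Hom[OF cmp_Hom[OF h q] i]] by simp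
    finally show "\<exists>u\<in>Hom C T X. i \<cdot> u = h" using cmp_Hom[OF h q] by metis
  next
    fix T u v
    assume u: "u \<in> Hom C T X" and v: "v \<in> Hom C T X" and eq: "i \<cdot> u = i \<cdot> v"
    have "u = (q \<cdot> i) \<cdot> u" using qi ident_left[OF u] by simp
    also have "\<dots> = (q \<cdot> i) \<cdot> v" using eq cmp_assoc[OF u i q] cmp_assoc[OF v i q] by simp
    also have "\<dots> = v" using qi ident_left[OF v] by simp
    finally show "u = v" .
  qed
  moreover have "is_cokernel C p i"
  proof (rule cokernelI[OF p i pi])
    fix T h
    assume h: "h \<in> Hom C S T" and hi: "h \<cdot> i = zero_arr C X T"
    note T = Hom_obj(2)[OF h]
    have "h = h \<cdot> add C (i \<cdot> q) (j \<cdot> p)" using sum ident_right[OF h] by simp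
    also have "\<dots> = add C ((h \<cdot> i) \<cdot> q) ((h \<cdot> j) \<cdot> p)"
      using cmp_add_right[OF iq jp h] cmp_assoc[OF q i h] cmp_assoc[OF p j h] by simp
    also have "\<dots> = (h \<cdot> j) \<cdot> p"
      using hi zero_cmp[OF q T] add_zero_left[OF cmp_Hom[OF p cmp_Hom[OF j h]]] by simp
    finally show "\<exists>u\<in>Hom C B T. u \<cdot> p = h" using cmp_Hom[OF j h] by metis
  next
    show "epic C p"
    \<comment> \<open>\<open>p \<cdot> j\<close> is an identity and therefore epic, which forces its
      last factor \<open>p\<close> to be epic.\<close>
    proof (rule epic_cmpD[OF j p], rule epicI)
      show "p \<cdot> j \<in> Hom C B B" using cmp_Hom[OF j p] .
    next
      fix T u v
      assume "u \<in> Hom C B T" "v \<in> Hom C B T" "u \<cdot> (p \<cdot> j) = v \<cdot> (p \<cdot> j)"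
      then show "u = v" using pj ident_right by simp
    qed
  qed
  ultimately show ?thesis unfolding short_exact_def by simp
qed

text \<open>\<open>Ext1_zero\<close> is an image under \<open>extension_equiv\<close>; reflexivity,
  witnessed by the identity arrow, shows that a split extension belongs to its own class.\<close>

lemma extension_class_refl:
  assumes "(i, p) \<in> extensions C A X"
  shows "((i, p), (i, p)) \<in> extension_equiv C A X"
proof -
  have p: "p \<in> Hom C (src C p) A" and i: "i \<in> Hom C X (src C p)"
    using assms unfolding extensions_def short_exact_def is_kernel_def Hom_def by auto
  note E = Hom_obj(1)[OF p]
  note id = ident_Hom[OF E]
  have "isomorphism C (ident C (src C p))"
    unfolding isomorphism_def using id ident_left[OF id] HomD[OF id] by auto
  then show ?thesis
    unfolding extension_equiv_def using assms id ident_left[OF i] ident_right[OF p] by blast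
qed

end

section \<open>Epimorphisms in an abelian category, and lifting along projective effacements\<close>

context abelian_category
begin

text \<open>Normality makes \<open>p\<close> the cokernel of some \<open>f\<close>, which may differ
  from \<open>k\<close>. But \<open>f\<close> factors through the kernel \<open>k\<close>, so every
  arrow that kills \<open>k\<close> kills \<open>f\<close> and hence factors through
  \<open>p\<close>.\<close>

lemma epic_cokernel_of_kernel:
  assumes ep: "epic C p" and k: "is_kernel C k p"
  shows "is_cokernel C p k"
proof -
  obtain f where pf: "is_cokernel C p f" using epic_normal[OF ep] by blast
  define A where "A = src C f"
  define B where "B = src C p"
  define D where "D = tgt C p"
  have p: "p \<in> Hom C B D" and f: "f \<in> Hom C A B" and pf0: "p \<cdot> f = zero_arr C A D"
    using pf unfolding is_cokernel_def Hom_def A_def B_def D_def by auto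
  note kH = kernel_Hom[OF k p]
  show ?thesis
  proof (rule cokernelI[OF p kH _ ep])
    fix T h
    assume h: "h \<in> Hom C B T" and hk: "h \<cdot> k = zero_arr C (src C k) T"
    obtain u where u: "u \<in> Hom C A (src C k)" and ku: "k \<cdot> u = f"
      using kernel_lift[OF k kH(1) p f pf0] .
    have "h \<cdot> f = zero_arr C A T"
      using cmp_assoc[OF u kH(1) h] hk ku zero_cmp[OF u Hom_obj(2)[OF h]] by simp
    then show "\<exists>u\<in>Hom C D T. u \<cdot> p = h"
      using cokernel_lift[OF pf p f h] by metis
  qed
qed

text \<open>The fibre product is built as the kernel of the difference map from the biproduct of
  \<open>B\<close> and \<open>A'\<close> to \<open>A\<close>. Only the commuting square and the
  epimorphism \<open>q\<close> are recorded, since the lifting argument uses nothing else.\<close>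

lemma epic_pullback:
  assumes p: "p \<in> Hom C B A" and ep: "epic C p" and f: "f \<in> Hom C A' A"
  obtains E g q where "g \<in> Hom C E B" "q \<in> Hom C E A'" "p \<cdot> g = f \<cdot> q" "epic C q"
proof -
  note A = Hom_obj(2)[OF p] and B = Hom_obj(1)[OF p] and A' = Hom_obj(1)[OF f]
  obtain i j r s where "is_biproduct C B A' i j r s" using ex_biproduct[OF B A'] by blast
  then obtain S where i: "i \<in> Hom C B S" and j: "j \<in> Hom C A' S" and r: "r \<in> Hom C S B"
    and s: "s \<in> Hom C S A'" and ri: "r \<cdot> i = ident C B" and sj: "s \<cdot> j = ident C A'"
    and si: "s \<cdot> i = zero_arr C B A'"
    unfolding is_biproduct_def by blast
  obtain f' where f': "f' \<in> Hom C A' A" and ff': "add C f f' = zero_arr C A' A"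
    using ex_neg[OF f] .
  \<comment> \<open>As \<open>f'\<close> is the negative of \<open>f\<close>, this is
    \<open>p\<close> on the first summand minus \<open>f\<close> on the second. It restricts to
    \<open>p\<close> along \<open>i\<close>, so it is epic.\<close>
  define d where "d = add C (p \<cdot> r) (f' \<cdot> s)"
  note pr = cmp_Hom[OF r p] and fs = cmp_Hom[OF s f']
  have d: "d \<in> Hom C S A" unfolding d_def using add_Hom[OF pr fs] .
  have "d \<cdot> i = add C (p \<cdot> (r \<cdot> i)) (f' \<cdot> (s \<cdot> i))"
    unfolding d_def using cmp_add_left[OF i pr fs] cmp_assoc[OF i r p] cmp_assoc[OF i s f'] by simp
  also have "\<dots> = p"
    using ri si cmp_zero[OF f' B] ident_right[OF p] add_zero_right[OF p] by simp
  finally have di: "d \<cdot> i = p" .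
  have ed: "epic C d" using epic_cmpD[OF i d] di ep by simp
  obtain k where k: "is_kernel C k d" using ex_kernel HomD(1)[OF d] by blast
  define E where "E = src C k"
  have kH: "k \<in> Hom C E S" and dk: "d \<cdot> k = zero_arr C E A"
    using kernel_Hom[OF k d] unfolding E_def by auto
  note rk = cmp_Hom[OF kH r] and sk = cmp_Hom[OF kH s]
  note cok = epic_cokernel_of_kernel[OF ed k]
  \<comment> \<open>Both sides of the square become zero after adding
    \<open>f' \<cdot> (s \<cdot> k)\<close>, so they agree.\<close>
  have "add C (p \<cdot> (r \<cdot> k)) (f' \<cdot> (s \<cdot> k)) = d \<cdot> k"
    unfolding d_def using cmp_add_left[OF kH pr fs] cmp_assoc[OF kH r p] cmp_assoc[OF kH s f'] by simp
  also have "\<dots> = add C f f' \<cdot> (s \<cdot> k)" using dk ff' zero_cmp[OF sk A] by simp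
  also have "\<dots> = add C (f \<cdot> (s \<cdot> k)) (f' \<cdot> (s \<cdot> k))" using cmp_add_left[OF sk f f'] .
  finally have comm: "p \<cdot> (r \<cdot> k) = f \<cdot> (s \<cdot> k)"
    using add_right_cancel[OF cmp_Hom[OF rk p] cmp_Hom[OF sk f] cmp_Hom[OF sk f']] by simp
  have "epic C (s \<cdot> k)"
  proof (rule epic_if_zero_cancel[OF sk])
    fix T u
    assume u: "u \<in> Hom C A' T" and usk: "u \<cdot> (s \<cdot> k) = zero_arr C E T"
    note T = Hom_obj(2)[OF u] and us = cmp_Hom[OF s u]
    \<comment> \<open>Since \<open>d\<close> is the cokernel of \<open>k\<close>, the arrow
      \<open>u \<cdot> s\<close> factors as \<open>w \<cdot> d\<close>. Restricting along
      \<open>i\<close> gives \<open>w \<cdot> p\<close> zero, hence \<open>w\<close> is zero;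
      restricting \<open>u \<cdot> s\<close> along \<open>j\<close> then gives \<open>u\<close>
      zero.\<close>
    have "(u \<cdot> s) \<cdot> k = zero_arr C E T" using usk cmp_assoc[OF kH s u] by simp
    then obtain w where w: "w \<in> Hom C A T" and wd: "w \<cdot> d = u \<cdot> s"
      using cokernel_lift[OF cok d kH us] by blast
    have "w \<cdot> p = u \<cdot> (s \<cdot> i)"
      using di wd cmp_assoc[OF i d w] cmp_assoc[OF i s u] by simp
    also have "\<dots> = zero_arr C A T \<cdot> p" using si cmp_zero[OF u B] zero_cmp[OF p T] by simp
    finally have "w = zero_arr C A T" using epic_cancel[OF ep p w zero_Hom[OF A T]] by simp
    then have us0: "u \<cdot> s = zero_arr C S T" using wd zero_cmp[OF d T] by simp
    have "u = (u \<cdot> s) \<cdot> j" using sj ident_right[OF u] cmp_assoc[OF j s u] by simp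
    then show "u = zero_arr C A' T" using us0 zero_cmp[OF j T] by simp
  qed
  then show ?thesis using that rk sk comm by blast
qed

text \<open>Turns the vanishing on \<open>Ext1\<close> into the lifting property. The epimorphism
  \<open>q\<close> and its kernel form an extension whose pullback along \<open>\<pi>\<close>
  splits; a section of the pullback followed by its map to the extension is the lift.\<close>

lemma projective_effacement_lift:
  assumes pe: "projective_effacement C \<pi>" and \<pi>: "\<pi> \<in> Hom C P A"
    and q: "q \<in> Hom C E A" and ep: "epic C q"
  obtains b where "b \<in> Hom C P E" "q \<cdot> b = \<pi>"
proof -
  obtain k where k: "is_kernel C k q" using ex_kernel HomD(1)[OF q] by blast
  define X where "X = src C k"
  have kH: "k \<in> Hom C X E" using kernel_Hom[OF k q] unfolding X_def by auto
  note X = Hom_obj(1)[OF kH] and P = Hom_obj(1)[OF \<pi>]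
  have ext: "(k, q) \<in> extensions C A X"
    using epic_cokernel_of_kernel[OF ep k] k HomD[OF q]
    unfolding extensions_def short_exact_def X_def by auto
  define c where "c = extension_equiv C A X `` {(k, q)}"
  have "c \<in> Ext1 C A X" unfolding Ext1_def c_def using ext by (rule quotientI)
  then have eq: "Ext1_map C \<pi> X c = Ext1_zero C P X"
    using pe X HomD[OF \<pi>] unfolding projective_effacement_def by auto
  obtain i j r p where bp: "is_biproduct C X P i j r p" using ex_biproduct[OF X P] by blast
  then have j: "j \<in> Hom C P (src C p)" and p: "p \<in> Hom C (src C p) P"
    and pj: "p \<cdot> j = ident C P" and i: "i \<in> Hom C X (src C p)"
    unfolding is_biproduct_def by (auto simp: Hom_def)
  \<comment> \<open>The standard split extension lies in the zero class, which equals the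
    pulled-back class. It is therefore itself a pullback along \<open>\<pi>\<close>, though of some
    representative \<open>(k', q')\<close> of \<open>c\<close> rather than of
    \<open>(k, q)\<close>.\<close>
  have "(i, p) \<in> extensions C P X"
    using biproduct_short_exact[OF bp] HomD[OF i] HomD[OF p] unfolding extensions_def by auto
  then have "(i, p) \<in> Ext1_zero C P X"
    unfolding Ext1_zero_def using extension_class_refl bp by blast
  then obtain k' q' \<phi> where kq': "(k', q') \<in> c" and pb: "is_pullback C \<phi> p q' \<pi>"
    using eq unfolding Ext1_map_def by blast
  obtain \<psi> where \<psi>: "\<psi> \<in> Hom C E (src C q')" and iso: "isomorphism C \<psi>" and q'\<psi>: "q' \<cdot> \<psi> = q"
    and "(k', q') \<in> extensions C A X"
    using kq' HomD[OF q] unfolding c_def extension_equiv_def by auto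
  then have q': "q' \<in> Hom C (src C q') A"
    unfolding extensions_def short_exact_def is_cokernel_def Hom_def by auto
  \<comment> \<open>The inverse of \<open>\<psi>\<close> carries the lift from the representative
    \<open>q'\<close> back to \<open>q\<close>: the section \<open>j\<close>, then
    \<open>\<phi>\<close>, then \<open>\<theta>\<close>.\<close>
  obtain \<theta> where \<theta>: "\<theta> \<in> Hom C (src C q') E" and \<psi>\<theta>: "\<psi> \<cdot> \<theta> = ident C (src C q')"
    using iso HomD[OF \<psi>] unfolding isomorphism_def by auto
  have \<phi>: "\<phi> \<in> Hom C (src C p) (src C q')" and comm: "q' \<cdot> \<phi> = \<pi> \<cdot> p"
    using pb unfolding is_pullback_def Hom_def by auto
  note \<phi>j = cmp_Hom[OF j \<phi>]
  have "q \<cdot> (\<theta> \<cdot> (\<phi> \<cdot> j)) = (q' \<cdot> (\<psi> \<cdot> \<theta>)) \<cdot> (\<phi> \<cdot> j)"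
    using q'\<psi> cmp_assoc[OF \<phi>j \<theta> q] cmp_assoc[OF \<theta> \<psi> q'] by simp
  also have "\<dots> = (\<pi> \<cdot> p) \<cdot> j"
    using \<psi>\<theta> ident_right[OF q'] cmp_assoc[OF j \<phi> q'] comm by simp
  also have "\<dots> = \<pi>" using cmp_assoc[OF j p \<pi>] pj ident_right[OF \<pi>] by simp
  finally show ?thesis using that cmp_Hom[OF \<phi>j \<theta>] by blast
qed

end

section \<open>The product functor over a fixed index set, and exactness in the functor
  category\<close>

locale preadditive_category_with_products =
  preadditive_category C for C :: "('o, 'm, 'z) preadditive_data_scheme" (structure) +
  fixes \<Sigma> :: "'i set"
  assumes ex_product: "(\<And>i. i \<in> \<Sigma> \<Longrightarrow> X i \<in> obj C) \<Longrightarrow> \<exists>P pr. is_product C \<Sigma> X P pr"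
begin

abbreviation "F \<equiv> Fun_discrete \<Sigma> C"

text \<open>Existence turns the Hilbert choice in \<open>product_cone\<close> into an actual product
  cone.\<close>

lemma is_product:
  assumes "\<And>i. i \<in> \<Sigma> \<Longrightarrow> X i \<in> obj C"
  shows "is_product C \<Sigma> X (product_obj C \<Sigma> X) (product_proj C \<Sigma> X)"
proof -
  have "\<exists>c. case c of (P, pr) \<Rightarrow> is_product C \<Sigma> X P pr" using ex_product[of X] assms by auto
  from someI_ex[OF this] show ?thesis
    unfolding product_obj_def product_proj_def product_cone_def by (simp split: prod.splits)
qed

lemma product_obj: "(\<And>i. i \<in> \<Sigma> \<Longrightarrow> X i \<in> obj C) \<Longrightarrow> product_obj C \<Sigma> X \<in> obj C"
  using is_product[of X] unfolding is_product_def by blast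

lemma product_proj:
  "(\<And>i. i \<in> \<Sigma> \<Longrightarrow> X i \<in> obj C) \<Longrightarrow> i \<in> \<Sigma> \<Longrightarrow> product_proj C \<Sigma> X i \<in> Hom C (product_obj C \<Sigma> X) (X i)"
  using is_product[of X] unfolding is_product_def by blast

lemma Hom_component: "f \<in> Hom F X Y \<Longrightarrow> i \<in> \<Sigma> \<Longrightarrow> f i \<in> Hom C (X i) (Y i)"
  by (simp add: Hom_Fun_discrete)

lemma Hom_product:
  assumes "f \<in> Hom F X Y"
  shows "is_product C \<Sigma> X (product_obj C \<Sigma> X) (product_proj C \<Sigma> X)"
    and "is_product C \<Sigma> Y (product_obj C \<Sigma> Y) (product_proj C \<Sigma> Y)"
    and "i \<in> \<Sigma> \<Longrightarrow> product_proj C \<Sigma> X i \<in> Hom C (product_obj C \<Sigma> X) (X i)"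
    and "i \<in> \<Sigma> \<Longrightarrow> product_proj C \<Sigma> Y i \<in> Hom C (product_obj C \<Sigma> Y) (Y i)"
    and "product_obj C \<Sigma> X \<in> obj C" "product_obj C \<Sigma> Y \<in> obj C"
  using Hom_obj[OF Hom_component[OF assms]] is_product product_proj product_obj by blast+

text \<open>The description in \<open>product_arr\<close> denotes: the family
  \<open>f i \<cdot> product_proj C \<Sigma> X i\<close> has a lift to the product, and joint
  monicity of the projections makes it unique.\<close>

lemma product_arr:
  assumes f: "f \<in> Hom F X Y"
  shows product_arr_Hom: "product_arr C \<Sigma> f \<in> Hom C (product_obj C \<Sigma> X) (product_obj C \<Sigma> Y)"
    and product_arr_proj:
      "i \<in> \<Sigma> \<Longrightarrow> product_proj C \<Sigma> Y i \<cdot> product_arr C \<Sigma> f = f i \<cdot> product_proj C \<Sigma> X i"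
proof -
  let ?Q = "\<lambda>h. h \<in> Hom C (product_obj C \<Sigma> X) (product_obj C \<Sigma> Y) \<and>
    (\<forall>i\<in>\<Sigma>. product_proj C \<Sigma> Y i \<cdot> h = f i \<cdot> product_proj C \<Sigma> X i)"
  note P = Hom_product[OF f]
  obtain h where h: "?Q h"
    using product_lift[OF P(2) P(5), of "\<lambda>i. f i \<cdot> product_proj C \<Sigma> X i"]
      cmp_Hom[OF P(3) Hom_component[OF f]] by metis
  have "h' = h" if "?Q h'" for h'
    using product_eqI[OF P(2), of h' _ h] that h by auto
  then have "?Q (THE h. ?Q h)" using theI[of ?Q] h by blast
  moreover have "src F f = X" "tgt F f = Y" using f by (auto simp: Hom_def)
  ultimately have "?Q (product_arr C \<Sigma> f)" unfolding product_arr_def Let_def by simp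
  then show "product_arr C \<Sigma> f \<in> Hom C (product_obj C \<Sigma> X) (product_obj C \<Sigma> Y)"
    "i \<in> \<Sigma> \<Longrightarrow> product_proj C \<Sigma> Y i \<cdot> product_arr C \<Sigma> f = f i \<cdot> product_proj C \<Sigma> X i"
    by auto
qed

text \<open>Reduces functoriality and additivity to checks after each projection.\<close>

lemma product_arr_eqI:
  assumes f: "f \<in> Hom F X Y" and h: "h \<in> Hom C (product_obj C \<Sigma> X) (product_obj C \<Sigma> Y)"
    and eq: "\<And>i. i \<in> \<Sigma> \<Longrightarrow> product_proj C \<Sigma> Y i \<cdot> h = f i \<cdot> product_proj C \<Sigma> X i"
  shows "product_arr C \<Sigma> f = h"
  using product_eqI[OF Hom_product(2)[OF f] product_arr_Hom[OF f] h] product_arr_proj[OF f] eq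
  by simp

lemma product_functor: "is_functor F C (product_obj C \<Sigma>) (product_arr C \<Sigma>)"
  unfolding is_functor_def
proof (intro conjI ballI impI)
  fix X assume "X \<in> obj F"
  then have X: "X \<in> extensional \<Sigma>" "\<And>i. i \<in> \<Sigma> \<Longrightarrow> X i \<in> obj C"
    by (auto simp: Fun_discrete_def PiE_iff)
  then show PX: "product_obj C \<Sigma> X \<in> obj C" using product_obj by blast
  have idF: "ident F X = (\<lambda>i\<in>\<Sigma>. ident C (X i))" by (simp add: Fun_discrete_def)
  have id: "ident F X \<in> Hom F X X" unfolding idF Hom_Fun_discrete using X ident_Hom by auto
  show "product_arr C \<Sigma> (ident F X) = ident C (product_obj C \<Sigma> X)"
  proof (rule product_arr_eqI[OF id ident_Hom[OF PX]])
    fix i assume i: "i \<in> \<Sigma>"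
    have pr: "product_proj C \<Sigma> X i \<in> Hom C (product_obj C \<Sigma> X) (X i)"
      using product_proj X(2) i by blast
    show "product_proj C \<Sigma> X i \<cdot> ident C (product_obj C \<Sigma> X) = ident F X i \<cdot> product_proj C \<Sigma> X i"
      using i ident_left[OF pr] ident_right[OF pr] by (simp add: idF)
  qed
next
  fix X Y f assume "f \<in> Hom F X Y"
  then show "product_arr C \<Sigma> f \<in> Hom C (product_obj C \<Sigma> X) (product_obj C \<Sigma> Y)"
    by (rule product_arr_Hom)
next
  fix f g assume "f \<in> arr F" "g \<in> arr F" and fg: "tgt F f = src F g"
  then obtain X Y Z where f: "f \<in> Hom F X Y" and g: "g \<in> Hom F Y Z"
    by (auto simp: Hom_def)
  have gfF: "g \<cdot>\<^bsub>F\<^esub> f = (\<lambda>i\<in>\<Sigma>. g i \<cdot> f i)" by (simp add: Fun_discrete_def)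
  have gf: "g \<cdot>\<^bsub>F\<^esub> f \<in> Hom F X Z"
    unfolding gfF using f g cmp_Hom unfolding Hom_Fun_discrete by auto
  note Pf = product_arr_Hom[OF f] and Pg = product_arr_Hom[OF g]
  show "product_arr C \<Sigma> (g \<cdot>\<^bsub>F\<^esub> f) = product_arr C \<Sigma> g \<cdot> product_arr C \<Sigma> f"
  proof (rule product_arr_eqI[OF gf cmp_Hom[OF Pf Pg]])
    fix i assume i: "i \<in> \<Sigma>"
    note fi = Hom_component[OF f i] and gi = Hom_component[OF g i]
    note prX = Hom_product(3)[OF f i] and prY = Hom_product(3)[OF g i]
      and prZ = Hom_product(4)[OF g i]
    show "product_proj C \<Sigma> Z i \<cdot> (product_arr C \<Sigma> g \<cdot> product_arr C \<Sigma> f) =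
        (g \<cdot>\<^bsub>F\<^esub> f) i \<cdot> product_proj C \<Sigma> X i"
      using i cmp_assoc[OF Pf Pg prZ] product_arr_proj[OF g i] cmp_assoc[OF Pf prY gi]
        product_arr_proj[OF f i] cmp_assoc[OF prX fi gi]
      by (simp add: gfF)
  qed
qed

lemma product_arr_add:
  assumes f: "f \<in> Hom F X Y" and g: "g \<in> Hom F X Y"
  shows "product_arr C \<Sigma> (add F f g) = add C (product_arr C \<Sigma> f) (product_arr C \<Sigma> g)"
proof -
  have fgF: "add F f g = (\<lambda>i\<in>\<Sigma>. add C (f i) (g i))" by (simp add: Fun_discrete_def)
  have fg: "add F f g \<in> Hom F X Y"
    unfolding fgF using f g add_Hom unfolding Hom_Fun_discrete by auto
  note Pf = product_arr_Hom[OF f] and Pg = product_arr_Hom[OF g]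
  show ?thesis
  proof (rule product_arr_eqI[OF fg add_Hom[OF Pf Pg]])
    fix i assume i: "i \<in> \<Sigma>"
    note prX = Hom_product(3)[OF f i] and prY = Hom_product(4)[OF f i]
    show "product_proj C \<Sigma> Y i \<cdot> add C (product_arr C \<Sigma> f) (product_arr C \<Sigma> g) =
        add F f g i \<cdot> product_proj C \<Sigma> X i"
      using i cmp_add_right[OF Pf Pg prY] product_arr_proj[OF f i] product_arr_proj[OF g i]
        cmp_add_left[OF prX Hom_component[OF f i] Hom_component[OF g i]]
      by (simp add: fgF)
  qed
qed

text \<open>Limits commute with limits: an arrow from \<open>T\<close> into a product is the same as
  an arrow from the constant family at \<open>T\<close>, so the universal property of
  \<open>k\<close> among families transfers to the product.\<close>

lemma product_kernel:
  assumes ker: "is_kernel F k p"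
  shows "is_kernel C (product_arr C \<Sigma> k) (product_arr C \<Sigma> p)"
proof -
  define K where "K = src F k"
  define B where "B = src F p"
  define A where "A = tgt F p"
  have k: "k \<in> Hom F K B" and p: "p \<in> Hom F B A" and pk: "p \<cdot>\<^bsub>F\<^esub> k = zero_arr F K A"
    using ker unfolding is_kernel_def Hom_def K_def B_def A_def by auto
  have univ: "\<exists>!u. u \<in> Hom F T K \<and> k \<cdot>\<^bsub>F\<^esub> u = h"
    if "h \<in> Hom F T B" "p \<cdot>\<^bsub>F\<^esub> h = zero_arr F T A" "T \<in> obj F" for h T
    using ker that unfolding is_kernel_def K_def B_def A_def by blast
  have cmpF: "g \<cdot>\<^bsub>F\<^esub> f = (\<lambda>i\<in>\<Sigma>. g i \<cdot> f i)" for f g by (simp add: Fun_discrete_def)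
  have zeroF: "zero_arr F X Y = (\<lambda>i\<in>\<Sigma>. zero_arr C (X i) (Y i))" for X Y
    by (simp add: Fun_discrete_def)
  note Pk = product_arr_Hom[OF k] and Pp = product_arr_Hom[OF p]
  note prK = Hom_product(3)[OF k] and prB = Hom_product(3)[OF p] and prA = Hom_product(4)[OF p]
  have pki: "p i \<cdot> k i = zero_arr C (K i) (A i)" if "i \<in> \<Sigma>" for i
    using fun_cong[OF pk, of i] that by (simp add: cmpF zeroF)
  show ?thesis
  proof (rule kernelI[OF Pk Pp])
    show "product_arr C \<Sigma> p \<cdot> product_arr C \<Sigma> k = zero_arr C (product_obj C \<Sigma> K) (product_obj C \<Sigma> A)"
    proof (rule product_eqI[OF Hom_product(2)[OF p] cmp_Hom[OF Pk Pp]
          zero_Hom[OF Hom_product(5)[OF k] Hom_product(6)[OF p]]])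
      fix i assume i: "i \<in> \<Sigma>"
      note ki = Hom_component[OF k i] and pi = Hom_component[OF p i]
      have "product_proj C \<Sigma> A i \<cdot> (product_arr C \<Sigma> p \<cdot> product_arr C \<Sigma> k) =
          (p i \<cdot> k i) \<cdot> product_proj C \<Sigma> K i"
        using cmp_assoc[OF Pk Pp prA[OF i]] product_arr_proj[OF p i]
          cmp_assoc[OF Pk prB[OF i] pi] product_arr_proj[OF k i] cmp_assoc[OF prK[OF i] ki pi]
        by simp
      also have "\<dots> = zero_arr C (product_obj C \<Sigma> K) (A i)"
        using pki[OF i] zero_cmp[OF prK[OF i] Hom_obj(2)[OF pi]] by simp
      finally show "product_proj C \<Sigma> A i \<cdot> (product_arr C \<Sigma> p \<cdot> product_arr C \<Sigma> k) =
          product_proj C \<Sigma> A i \<cdot> zero_arr C (product_obj C \<Sigma> K) (product_obj C \<Sigma> A)"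
        using cmp_zero[OF prA[OF i] Hom_product(5)[OF k]] by simp
    qed
  next
    fix T h
    assume h: "h \<in> Hom C T (product_obj C \<Sigma> B)"
      and ph: "product_arr C \<Sigma> p \<cdot> h = zero_arr C T (product_obj C \<Sigma> A)"
    note T = Hom_obj(1)[OF h]
    \<comment> \<open>The components of \<open>h\<close> form an arrow of families out of the
      constant family. It is killed by \<open>p\<close>, so it factors through \<open>k\<close>; the
      components of the factorization then assemble to \<open>v\<close>.\<close>
    let ?T = "\<lambda>i\<in>\<Sigma>. T" and ?h = "\<lambda>i\<in>\<Sigma>. product_proj C \<Sigma> B i \<cdot> h"
    have "?T \<in> obj F" using T by (simp add: Fun_discrete_def)
    moreover have hF: "?h \<in> Hom F ?T B"
      using p cmp_Hom[OF h prB] by (simp add: Hom_Fun_discrete)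
    moreover have "p i \<cdot> (product_proj C \<Sigma> B i \<cdot> h) = zero_arr C T (A i)" if i: "i \<in> \<Sigma>" for i
      using cmp_assoc[OF h prB[OF i] Hom_component[OF p i]] product_arr_proj[OF p i]
        cmp_assoc[OF h Pp prA[OF i]] ph cmp_zero[OF prA[OF i] T] by simp
    then have "p \<cdot>\<^bsub>F\<^esub> ?h = zero_arr F ?T A" by (auto simp: cmpF zeroF fun_eq_iff)
    ultimately obtain u where u: "u \<in> Hom F ?T K" and ku: "k \<cdot>\<^bsub>F\<^esub> u = ?h" using univ by blast
    have ui: "u i \<in> Hom C T (K i)" if "i \<in> \<Sigma>" for i
      using Hom_component[OF u that] that by simp
    have kui: "k i \<cdot> u i = product_proj C \<Sigma> B i \<cdot> h" if "i \<in> \<Sigma>" for i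
      using fun_cong[OF ku, of i] that by (simp add: cmpF)
    obtain v where v: "v \<in> Hom C T (product_obj C \<Sigma> K)"
      and prv: "\<And>i. i \<in> \<Sigma> \<Longrightarrow> product_proj C \<Sigma> K i \<cdot> v = u i"
      using product_lift[OF Hom_product(1)[OF k] T ui] by blast
    have "product_arr C \<Sigma> k \<cdot> v = h"
    proof (rule product_eqI[OF Hom_product(1)[OF p] cmp_Hom[OF v Pk] h])
      fix i assume i: "i \<in> \<Sigma>"
      show "product_proj C \<Sigma> B i \<cdot> (product_arr C \<Sigma> k \<cdot> v) = product_proj C \<Sigma> B i \<cdot> h"
        using cmp_assoc[OF v Pk prB[OF i]] product_arr_proj[OF k i]
          cmp_assoc[OF v prK[OF i] Hom_component[OF k i]] prv[OF i] kui[OF i] by simp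
    qed
    then show "\<exists>u\<in>Hom C T (product_obj C \<Sigma> K). product_arr C \<Sigma> k \<cdot> u = h" using v by blast
  next
    fix T u v
    assume u: "u \<in> Hom C T (product_obj C \<Sigma> K)" and v: "v \<in> Hom C T (product_obj C \<Sigma> K)"
      and eq: "product_arr C \<Sigma> k \<cdot> u = product_arr C \<Sigma> k \<cdot> v"
    note T = Hom_obj(1)[OF u]
    let ?T = "\<lambda>i\<in>\<Sigma>. T"
    let ?u = "\<lambda>i\<in>\<Sigma>. product_proj C \<Sigma> K i \<cdot> u" and ?v = "\<lambda>i\<in>\<Sigma>. product_proj C \<Sigma> K i \<cdot> v"
    have TF: "?T \<in> obj F" using T by (simp add: Fun_discrete_def)
    have uF: "?u \<in> Hom F ?T K" and vF: "?v \<in> Hom F ?T K"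
      using k cmp_Hom[OF u prK] cmp_Hom[OF v prK] by (simp_all add: Hom_Fun_discrete)
    have kw: "k i \<cdot> (product_proj C \<Sigma> K i \<cdot> w) = product_proj C \<Sigma> B i \<cdot> (product_arr C \<Sigma> k \<cdot> w)"
      if w: "w \<in> Hom C T (product_obj C \<Sigma> K)" and i: "i \<in> \<Sigma>" for w i
      using cmp_assoc[OF w prK[OF i] Hom_component[OF k i]] product_arr_proj[OF k i]
        cmp_assoc[OF w Pk prB[OF i]] by simp
    \<comment> \<open>Both families of components factor the same arrow through \<open>k\<close>.
      That arrow is killed by \<open>p\<close>, so uniqueness among families applies and
      \<open>u\<close>, \<open>v\<close> have equal projections.\<close>
    have same: "k \<cdot>\<^bsub>F\<^esub> ?u = k \<cdot>\<^bsub>F\<^esub> ?v"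
      using kw[OF u] kw[OF v] eq by (auto simp: cmpF fun_eq_iff)
    have kv: "k \<cdot>\<^bsub>F\<^esub> ?v \<in> Hom F ?T B"
      using k vF cmp_Hom unfolding Hom_Fun_discrete cmpF by auto
    have "p i \<cdot> (k i \<cdot> (product_proj C \<Sigma> K i \<cdot> v)) = zero_arr C T (A i)" if i: "i \<in> \<Sigma>" for i
      using cmp_assoc[OF cmp_Hom[OF v prK[OF i]] Hom_component[OF k i] Hom_component[OF p i]]
        pki[OF i] zero_cmp[OF cmp_Hom[OF v prK[OF i]] Hom_obj(2)[OF Hom_component[OF p i]]] by simp
    then have "p \<cdot>\<^bsub>F\<^esub> (k \<cdot>\<^bsub>F\<^esub> ?v) = zero_arr F ?T A" by (auto simp: cmpF zeroF fun_eq_iff)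
    from univ[OF kv this TF] have "?u = ?v" using uF vF same by blast
    then have "product_proj C \<Sigma> K i \<cdot> u = product_proj C \<Sigma> K i \<cdot> v" if "i \<in> \<Sigma>" for i
      using that by (auto dest: fun_cong[where x = i])
    then show "u = v" using product_eqI[OF Hom_product(1)[OF k] u v] by blast
  qed
qed

text \<open>Cancellation is known only for arrows of whole families, so a pair of arrows out of
  \<open>A i\<close> is extended by identities at the other indices.\<close>

lemma cokernel_component_epic:
  assumes cok: "is_cokernel F p k" and i: "i \<in> \<Sigma>"
  shows "epic C (p i)"
proof -
  define K where "K = src F k"
  define B where "B = src F p"
  define A where "A = tgt F p"
  have k: "k \<in> Hom F K B" and p: "p \<in> Hom F B A" and pk: "p \<cdot>\<^bsub>F\<^esub> k = zero_arr F K A"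
    using cok unfolding is_cokernel_def Hom_def K_def B_def A_def by auto
  have univ: "\<exists>!u. u \<in> Hom F A T \<and> u \<cdot>\<^bsub>F\<^esub> p = h"
    if "h \<in> Hom F B T" "h \<cdot>\<^bsub>F\<^esub> k = zero_arr F K T" "T \<in> obj F" for h T
    using cok that HomD unfolding is_cokernel_def K_def B_def A_def by force
  have cmpF: "g \<cdot>\<^bsub>F\<^esub> f = (\<lambda>i\<in>\<Sigma>. g i \<cdot> f i)" for f g by (simp add: Fun_discrete_def)
  have zeroF: "zero_arr F X Y = (\<lambda>i\<in>\<Sigma>. zero_arr C (X i) (Y i))" for X Y
    by (simp add: Fun_discrete_def)
  have pkj: "p j \<cdot> k j = zero_arr C (K j) (A j)" if "j \<in> \<Sigma>" for j
    using fun_cong[OF pk, of j] that by (simp add: cmpF zeroF)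
  note pj = Hom_component[OF p]
  show ?thesis
  proof (rule epicI[OF pj[OF i]])
    fix T u v
    assume u: "u \<in> Hom C (A i) T" and v: "v \<in> Hom C (A i) T" and eq: "u \<cdot> p i = v \<cdot> p i"
    note T = Hom_obj(2)[OF u]
    \<comment> \<open>\<open>w x\<close> is \<open>x\<close> at \<open>i\<close> and the identity
      elsewhere. As \<open>u\<close> and \<open>v\<close> agree after \<open>p i\<close>, the
      families \<open>w u\<close> and \<open>w v\<close> agree after \<open>p\<close>; the common
      composite kills \<open>k\<close>, so it factors uniquely through \<open>p\<close>. Evaluation
      at \<open>i\<close> recovers \<open>u\<close> and \<open>v\<close>.\<close>
    define T' where "T' = A(i := T)"
    define w where "w x = (\<lambda>j\<in>\<Sigma>. ident C (A j))(i := x)" for x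
    have wH: "w x \<in> Hom F A T'" if "x \<in> Hom C (A i) T" for x
      using p i that ident_Hom Hom_obj(2)[OF pj]
      unfolding Hom_Fun_discrete w_def T'_def extensional_def by auto
    have T'F: "T' \<in> obj F"
      using p i T Hom_obj(2)[OF pj] unfolding Hom_Fun_discrete T'_def
      by (auto simp: Fun_discrete_def PiE_iff extensional_def)
    have wp: "w u \<cdot>\<^bsub>F\<^esub> p = w v \<cdot>\<^bsub>F\<^esub> p" using eq by (auto simp: cmpF fun_eq_iff w_def)
    have wpH: "w v \<cdot>\<^bsub>F\<^esub> p \<in> Hom F B T'"
      using p wH[OF v] cmp_Hom unfolding Hom_Fun_discrete cmpF by auto
    have "(w v j \<cdot> p j) \<cdot> k j = zero_arr C (K j) (T' j)" if j: "j \<in> \<Sigma>" for j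
    proof -
      note kj = Hom_component[OF k j] and wj = Hom_component[OF wH[OF v] j]
      show ?thesis
        using cmp_assoc[OF kj pj[OF j] wj] pkj[OF j] cmp_zero[OF wj Hom_obj(1)[OF kj]] by simp
    qed
    then have "(w v \<cdot>\<^bsub>F\<^esub> p) \<cdot>\<^bsub>F\<^esub> k = zero_arr F K T'" by (auto simp: cmpF zeroF fun_eq_iff)
    from univ[OF wpH this T'F] have "w u = w v" using wH[OF u] wH[OF v] wp by blast
    then show "u = v" by (auto simp: w_def dest: fun_cong[where x = i])
  qed
qed

end

section \<open>Products of epimorphisms, and exactness of the product functor\<close>

lemma (in abelian_category) product_arr_epic:
  assumes prod: "preadditive_category_with_products C \<Sigma>"
    and enough: "enough_projective_effacements C"
    and p: "p \<in> Hom (Fun_discrete \<Sigma> C) B A" and ep: "\<And>i. i \<in> \<Sigma> \<Longrightarrow> epic C (p i)"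
  shows "epic C (product_arr C \<Sigma> p)"
proof -
  interpret preadditive_category_with_products C \<Sigma> by (rule prod)
  note prA = Hom_product(4)[OF p] and prB = Hom_product(3)[OF p]
  note Pp = product_arr_Hom[OF p]
  obtain \<pi> where pe: "projective_effacement C \<pi>" and "tgt C \<pi> = product_obj C \<Sigma> A"
    using enough Hom_product(6)[OF p] unfolding enough_projective_effacements_def by blast
  moreover have e\<pi>: "epic C \<pi>" using pe unfolding projective_effacement_def by blast
  moreover define P where "P = src C \<pi>"
  ultimately have \<pi>: "\<pi> \<in> Hom C P (product_obj C \<Sigma> A)" unfolding epic_def Hom_def by auto
  have "\<exists>b\<in>Hom C P (B i). p i \<cdot> b = product_proj C \<Sigma> A i \<cdot> \<pi>" if i: "i \<in> \<Sigma>" for i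
  proof -
    note pi = Hom_component[OF p i]
    \<comment> \<open>\<open>p i\<close> ends at \<open>A i\<close>, whereas \<open>\<pi>\<close>
      ends at the product; the pullback \<open>q\<close> is an epimorphism onto the target of
      \<open>\<pi>\<close>, to which the effacement property applies.\<close>
    obtain E g q where g: "g \<in> Hom C E (B i)" and q: "q \<in> Hom C E (product_obj C \<Sigma> A)"
      and comm: "p i \<cdot> g = product_proj C \<Sigma> A i \<cdot> q" and eq: "epic C q"
      using epic_pullback[OF pi ep[OF i] prA[OF i]] .
    obtain b where b: "b \<in> Hom C P E" and qb: "q \<cdot> b = \<pi>"
      using projective_effacement_lift[OF pe \<pi> q eq] .
    have "p i \<cdot> (g \<cdot> b) = product_proj C \<Sigma> A i \<cdot> \<pi>"
      using cmp_assoc[OF b g pi] comm cmp_assoc[OF b q prA[OF i]] qb by simp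
    then show ?thesis using cmp_Hom[OF b g] by blast
  qed
  then obtain b where b: "\<And>i. i \<in> \<Sigma> \<Longrightarrow> b i \<in> Hom C P (B i)"
    and pb: "\<And>i. i \<in> \<Sigma> \<Longrightarrow> p i \<cdot> b i = product_proj C \<Sigma> A i \<cdot> \<pi>" by metis
  obtain c where c: "c \<in> Hom C P (product_obj C \<Sigma> B)"
    and prc: "\<And>i. i \<in> \<Sigma> \<Longrightarrow> product_proj C \<Sigma> B i \<cdot> c = b i"
    using product_lift[OF Hom_product(1)[OF p] Hom_obj(1)[OF \<pi>] b] by blast
  have "product_arr C \<Sigma> p \<cdot> c = \<pi>"
  proof (rule product_eqI[OF Hom_product(2)[OF p] cmp_Hom[OF c Pp] \<pi>])
    fix i assume i: "i \<in> \<Sigma>"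
    show "product_proj C \<Sigma> A i \<cdot> (product_arr C \<Sigma> p \<cdot> c) = product_proj C \<Sigma> A i \<cdot> \<pi>"
      using cmp_assoc[OF c Pp prA[OF i]] product_arr_proj[OF p i]
        cmp_assoc[OF c prB[OF i] Hom_component[OF p i]] prc[OF i] pb[OF i] by simp
  qed
  then show ?thesis using epic_cmpD[OF c Pp] e\<pi> by simp
qed

theorem proposition13:
  fixes C :: "('o, 'm) preadditive_data" and small :: "'i set \<Rightarrow> bool"
  assumes "abelian_category C"
    and "Ab3star small C"
    and "enough_projective_effacements C"
  shows "Ab4star small C"
proof -
  interpret abelian_category C by (rule assms(1))
  have "exact_functor (Fun_discrete \<Sigma> C) C (product_obj C \<Sigma>) (product_arr C \<Sigma>)"
    if \<Sigma>: "small \<Sigma>" for \<Sigma>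
  proof -
    \<comment> \<open>Smallness of \<open>\<Sigma>\<close> yields the products required by the
      locale.\<close>
    interpret P: preadditive_category_with_products C \<Sigma>
      using assms(2) \<Sigma> unfolding Ab3star_def by unfold_locales blast
    have "short_exact C (product_arr C \<Sigma> k) (product_arr C \<Sigma> p)"
      if se: "short_exact (Fun_discrete \<Sigma> C) k p" for k p
    proof -
      have ker: "is_kernel (Fun_discrete \<Sigma> C) k p" and cok: "is_cokernel (Fun_discrete \<Sigma> C) p k"
        using se unfolding short_exact_def by auto
      have p: "p \<in> Hom (Fun_discrete \<Sigma> C) (src (Fun_discrete \<Sigma> C) p) (tgt (Fun_discrete \<Sigma> C) p)"
        using ker unfolding is_kernel_def Hom_def by simp
      have "epic C (product_arr C \<Sigma> p)"
        using product_arr_epic[OF P.preadditive_category_with_products_axioms assms(3) p]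
          P.cokernel_component_epic[OF cok] by blast
      \<comment> \<open>The product of the kernels is a kernel of the product map, and an
        epimorphism is the cokernel of its kernel, so both halves of short exactness follow.\<close>
      then show ?thesis
        using epic_cokernel_of_kernel P.product_kernel[OF ker] unfolding short_exact_def by blast
    qed
    then show ?thesis
      unfolding exact_functor_def using P.product_functor P.product_arr_add by blast
  qed
  then show ?thesis unfolding Ab4star_def using assms(2) by blast
qed

end
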